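(* Let $\mu:[0,\infty)\to[0,\infty)$, $I\mapsto\mu(I)$, be a smooth function, and for $\dot\gamma\ge0$ put $\tilde\mu(\dot\gamma)=\mu(2\dot\gamma^2)$ (the viscosity as a function of the shear rate $\dot\gamma=\sqrt{I/2}$). Then the condition $$\mu(I)+2\min\Big\{\frac{d\mu(I)}{dI},\,0\Big\}\,I\ \ge\ 0\qquad\text{for all } I\ge0$$ is equivalent to $$\frac{d}{d\dot\gamma}\big[\dot\gamma\,\tilde\mu(\dot\gamma)\big]\ge0\qquad\text{for all }\dot\gamma\ge0,$$ that is, to the statement that the magnitude $\sqrt{T:T}=\sqrt2\,\dot\gamma\,\tilde\mu(\dot\gamma)$ of the stress tensor $T=\mu(\mathrm{tr}(S^2))S$ is a monotone increasing (i.e. nondecreasing) function of the shear rate $\dot\gamma\geq 0$.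
   Context: For a generalized Newtonian fluid with velocity $v$, the rate-of-strain tensor is $S=\nabla v+(\nabla v)^t$ (a symmetric matrix), $I=\mathrm{tr}(S^2)$, the shear rate is $\dot\gamma=\sqrt{I/2}$, the viscosity is $\mu=\mu(I)\ge0$, and the stress tensor is $T=\mu(I)S$. For matrices, $T:T=\sum_{a,b}T_{ab}T_{ab}$. *)

theory Defs
  imports "HOL-Analysis.Analysis"
begin

text \<open>Derivatives are taken within \<open>A\<close>, so for \<open>A = {0..}\<close> they are one-sided at \<open>0\<close>,
  and the values of \<open>f\<close> outside \<open>A\<close> are irrelevant. \<open>D k\<close> is the \<open>k\<close>-th derivative.\<close>

definition smooth_within :: "real set \<Rightarrow> (real \<Rightarrow> real) \<Rightarrow> bool" where
  "smooth_within A f \<longleftrightarrow> (\<exists>D :: nat \<Rightarrow> real \<Rightarrow> real. (\<forall>x\<in>A. D 0 x = f x) \<and>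
     (\<forall>k. \<forall>x\<in>A. (D k has_real_derivative D (Suc k) x) (at x within A)))"

text \<open>For a real function on \<open>{0..}\<close>, \<open>vector_derivative\<close> within \<open>{0..}\<close> is the ordinary
  derivative at positive points and the right derivative at \<open>0\<close>.\<close>

definition deriv_nonneg :: "(real \<Rightarrow> real) \<Rightarrow> real \<Rightarrow> real" where
  "deriv_nonneg f x = vector_derivative f (at x within {0..})"

definition shear_viscosity :: "(real \<Rightarrow> real) \<Rightarrow> real \<Rightarrow> real" where
  "shear_viscosity \<mu> \<gamma> = \<mu> (2 * \<gamma>\<^sup>2)"

definition rate_of_strain :: "(real^'n \<Rightarrow> real^'n) \<Rightarrow> real^'n \<Rightarrow> real^'n^'n" where
  "rate_of_strain v x = jacobian v (at x) + transpose (jacobian v (at x))"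

definition strain_invariant :: "real^'n^'n \<Rightarrow> real" where
  "strain_invariant S = trace (S ** S)"

definition shear_rate :: "real^'n^'n \<Rightarrow> real" where
  "shear_rate S = sqrt (strain_invariant S / 2)"

definition stress :: "(real \<Rightarrow> real) \<Rightarrow> real^'n^'n \<Rightarrow> real^'n^'n" where
  "stress \<mu> S = \<mu> (strain_invariant S) *\<^sub>R S"

definition double_contraction :: "real^'n^'n \<Rightarrow> real^'n^'n \<Rightarrow> real" where
  "double_contraction A B = (\<Sum>a\<in>UNIV. \<Sum>b\<in>UNIV. A $ a $ b * B $ a $ b)"

definition stress_magnitude :: "(real \<Rightarrow> real) \<Rightarrow> real^'n^'n \<Rightarrow> real" where
  "stress_magnitude \<mu> S = sqrt (double_contraction (stress \<mu> S) (stress \<mu> S))"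

end

theory Submission
  imports Defs
begin

text \<open>The chain rule gives
  \<open>d/d\<gamma> [\<gamma> \<mu>(2 \<gamma>\<^sup>2)] = \<mu>(I) + 2 \<mu>'(I) I\<close> with \<open>I = 2 \<gamma>\<^sup>2\<close>, and replacing \<open>\<mu>'\<close> by
  \<open>min \<mu>' 0\<close> does not change the sign condition because \<open>\<mu> \<ge> 0\<close>. Monotonicity over
  all flows is monotonicity in the shear rate, since the dilations \<open>z \<mapsto> c z\<close> attain every shear
  rate \<open>\<ge> 0\<close>.\<close>

text \<open>Difference quotients of a monotone function are nonnegative from either side, and the
  bound passes to the limit. At an isolated point every \<open>d\<close> would be a derivative,
  hence the assumption on the filter.\<close>

lemma has_real_derivative_nonneg_if_mono_on:
  fixes f :: "real \<Rightarrow> real"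
  assumes mono: "mono_on S f" and "x \<in> S" and nontrivial: "at x within S \<noteq> bot"
    and deriv: "(f has_real_derivative d) (at x within S)"
  shows "d \<ge> 0"
proof (rule tendsto_lowerbound[OF _ _ nontrivial])
  show "((\<lambda>y. (f y - f x) / (y - x)) \<longlongrightarrow> d) (at x within S)"
    using deriv by (simp add: has_field_derivative_iff)
  have "(f y - f x) / (y - x) \<ge> 0" if "y \<in> S" for y
    using mono_onD[OF mono, of x y] mono_onD[OF mono, of y x] that \<open>x \<in> S\<close>
    by (cases "x \<le> y") (auto simp: divide_nonpos_nonpos)
  then show "\<forall>\<^sub>F y in at x within S. (f y - f x) / (y - x) \<ge> 0"
    by (auto simp: eventually_at_filter)
qed

text \<open>Every point of \<open>{a..}\<close>, the endpoint included, is approached from the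
  right; so one-sided derivatives at \<open>a\<close> are unique.\<close>

lemma at_within_atLeast_neq_bot:
  fixes x :: real
  assumes "x \<ge> a"
  shows "at x within {a..} \<noteq> bot"
proof -
  have "at_right x \<le> at x within {a..}"
    using assms by (intro at_le) auto
  then show ?thesis
    using trivial_limit_at_right_real[of x] by (metis bot.extremum_uniqueI)
qed

lemma mono_on_atLeast_iff_deriv_nonneg:
  fixes f :: "real \<Rightarrow> real"
  assumes deriv: "\<And>x. x \<ge> a \<Longrightarrow> (f has_real_derivative f' x) (at x within {a..})"
  shows "mono_on {a..} f \<longleftrightarrow> (\<forall>x\<ge>a. f' x \<ge> 0)"
proof
  assume "mono_on {a..} f"
  then show "\<forall>x\<ge>a. f' x \<ge> 0"
    using has_real_derivative_nonneg_if_mono_on at_within_atLeast_neq_bot deriv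
    by (metis atLeast_iff)
next
  assume nonneg: "\<forall>x\<ge>a. f' x \<ge> 0"
  have cont: "continuous_on {a..} f"
    by (metis DERIV_continuous_on atLeast_iff deriv)
  show "mono_on {a..} f"
  proof (rule mono_onI)
    fix x y assume xy: "x \<in> {a..}" "y \<in> {a..}" "x \<le> y"
    show "f x \<le> f y"
    \<comment> \<open>This form of the mean value argument asks for two-sided derivatives only
      strictly between \<open>x\<close> and \<open>y\<close>. Such points exceed \<open>a\<close>,
      where the derivative within \<open>{a..}\<close> is two-sided; continuity covers a left end at
      \<open>a\<close>.\<close>
    proof (rule DERIV_nonneg_imp_increasing_open[OF \<open>x \<le> y\<close>])
      show "continuous_on {x..y} f"
        using cont xy by (auto intro: continuous_on_subset)
      fix z assume "x < z" "z < y"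
      then have "z > a" using xy by simp
      then have "at z within {a..} = at z"
        by (intro at_within_interior) simp
      then show "\<exists>d. (f has_real_derivative d) (at z) \<and> 0 \<le> d"
        using deriv[of z] nonneg \<open>z > a\<close> by auto
    qed
  qed
qed

lemma deriv_nonneg_eqI:
  assumes "(f has_real_derivative d) (at x within {0..})" and "x \<ge> 0"
  shows "deriv_nonneg f x = d"
  using at_within_atLeast_neq_bot[OF assms(2)] assms(1)
  unfolding deriv_nonneg_def has_real_derivative_iff_has_vector_derivative
  by (rule vector_derivative_within)

lemma smooth_within_atLeast_has_deriv_nonneg:
  assumes "smooth_within {0..} f" and "x \<ge> 0"
  shows "(f has_real_derivative deriv_nonneg f x) (at x within {0..})"
proof -
  from assms(1) obtain D where D: "\<And>y. y \<ge> 0 \<Longrightarrow> D 0 y = f y"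
    and D': "\<And>k y. y \<ge> 0 \<Longrightarrow> (D k has_real_derivative D (Suc k) y) (at y within {0..})"
    unfolding smooth_within_def by (metis atLeast_iff)
  \<comment> \<open>\<open>D 0\<close> agrees with \<open>f\<close> on all of \<open>{0..}\<close>,
    so the radius \<open>1\<close> of the transfer is arbitrary.\<close>
  have "(f has_real_derivative D 1 x) (at x within {0..})"
    using D'[of x 0] D \<open>x \<ge> 0\<close>
    by (auto intro: has_field_derivative_transform_within[of _ _ _ _ 1])
  then show ?thesis
    using deriv_nonneg_eqI \<open>x \<ge> 0\<close> by metis
qed

text \<open>Product and chain rule: the inner derivative is \<open>4 * \<gamma>\<close>, and
  \<open>\<gamma> * d * (4 * \<gamma>)\<close> is \<open>2 * d * (2 * \<gamma>\<^sup>2)\<close>. The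
  inner map sends \<open>{0..}\<close> into itself, so a derivative of \<open>\<mu>\<close> within
  \<open>{0..}\<close> suffices.\<close>

lemma has_real_derivative_shear_stress:
  assumes "(\<mu> has_real_derivative d) (at (2 * \<gamma>\<^sup>2) within {0..})"
  shows "((\<lambda>g. g * shear_viscosity \<mu> g) has_real_derivative
           \<mu> (2 * \<gamma>\<^sup>2) + 2 * d * (2 * \<gamma>\<^sup>2)) (at \<gamma> within {0..})"
proof -
  have "((\<mu> \<circ> (\<lambda>g. 2 * g\<^sup>2)) has_real_derivative d * (4 * \<gamma>)) (at \<gamma> within {0..})"
  proof (rule DERIV_image_chain)
    show "(\<mu> has_real_derivative d) (at (2 * \<gamma>\<^sup>2) within (\<lambda>g. 2 * g\<^sup>2) ` {0..})"
      by (rule has_field_derivative_subset[OF assms]) auto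
    show "((\<lambda>g. 2 * g\<^sup>2) has_real_derivative 4 * \<gamma>) (at \<gamma> within {0..})"
      by (auto intro!: derivative_eq_intros)
  qed
  then have "((\<lambda>g. \<mu> (2 * g\<^sup>2)) has_real_derivative d * (4 * \<gamma>)) (at \<gamma> within {0..})"
    by (simp add: o_def)
  then show ?thesis
    unfolding shear_viscosity_def
    by (auto intro!: derivative_eq_intros simp: power2_eq_square)
qed

text \<open>The substitution between the invariant and the shear rate is onto: \<open>x\<close> is
  reached from \<open>sqrt (x / 2)\<close>.\<close>

lemma all_nonneg_iff_all_double_square:
  "(\<forall>x\<ge>0. P x) \<longleftrightarrow> (\<forall>g\<ge>0. P (2 * g\<^sup>2))" for P :: "real \<Rightarrow> bool"
proof safe
  fix x :: real assume P: "\<forall>g\<ge>0. P (2 * g\<^sup>2)" and "x \<ge> 0"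
  then have "2 * (sqrt (x / 2))\<^sup>2 = x" by simp
  then show "P x" using P \<open>x \<ge> 0\<close> by (metis divide_nonneg_pos real_sqrt_ge_zero zero_less_numeral)
qed simp

text \<open>The trace is the sum of \<open>S $ a $ b * S $ b $ a\<close>, which symmetry turns into
  a sum of squares. This is what makes the invariant nonnegative.\<close>

lemma strain_invariant_eq_double_contraction:
  assumes "transpose S = S"
  shows "strain_invariant S = double_contraction S S"
proof -
  have "S $ a $ b = S $ b $ a" for a b
    by (subst assms[symmetric]) (simp add: transpose_def)
  then show ?thesis
    by (simp add: strain_invariant_def double_contraction_def trace_def matrix_matrix_mult_def)
qed

lemma transpose_rate_of_strain: "transpose (rate_of_strain v x) = rate_of_strain v x"
  by (simp add: rate_of_strain_def transpose_def vec_eq_iff)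

lemma shear_rate_nonneg:
  assumes "transpose S = S"
  shows "shear_rate S \<ge> 0"
  by (simp add: shear_rate_def strain_invariant_eq_double_contraction[OF assms]
      double_contraction_def sum_nonneg)

text \<open>The scalar viscosity leaves the contraction as a square, and its root carries no
  absolute value because \<open>\<mu>\<close> is nonnegative at the invariant.\<close>

lemma stress_magnitude_eq:
  assumes sym: "transpose S = S" and nonneg: "\<And>I. I \<ge> 0 \<Longrightarrow> \<mu> I \<ge> 0"
  shows "stress_magnitude \<mu> S = sqrt 2 * shear_rate S * shear_viscosity \<mu> (shear_rate S)"
proof -
  let ?I = "strain_invariant S"
  have I: "?I \<ge> 0"
    by (simp add: strain_invariant_eq_double_contraction[OF sym] double_contraction_def sum_nonneg)
  have "double_contraction (stress \<mu> S) (stress \<mu> S) = (\<mu> ?I)\<^sup>2 * double_contraction S S"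
    by (simp add: double_contraction_def stress_def sum_distrib_left power2_eq_square ac_simps)
  then have "stress_magnitude \<mu> S = \<mu> ?I * sqrt ?I"
    using nonneg[OF I]
    by (simp add: stress_magnitude_def real_sqrt_mult strain_invariant_eq_double_contraction[OF sym])
  moreover have "2 * (shear_rate S)\<^sup>2 = ?I" and "sqrt 2 * shear_rate S = sqrt ?I"
    using I by (simp_all add: shear_rate_def flip: real_sqrt_mult)
  ultimately show ?thesis
    by (simp add: shear_viscosity_def)
qed

lemma rate_of_strain_dilation:
  "rate_of_strain (\<lambda>z :: real^'n. c *\<^sub>R z) x = (2 * c) *\<^sub>R mat 1"
proof -
  have "jacobian (\<lambda>z :: real^'n. c *\<^sub>R z) (at x) = matrix (\<lambda>z. c *\<^sub>R z)"
    unfolding jacobian_def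
    by (subst frechet_derivative_at[symmetric])
      (auto intro: bounded_linear_imp_has_derivative bounded_linear_scaleR_right)
  then show ?thesis
    by (auto simp: rate_of_strain_def vec_eq_iff matrix_def transpose_def mat_def axis_def)
qed

text \<open>The rate of strain is \<open>2 * c\<close> times the identity, so the trace of its
  square is \<open>4 * c\<^sup>2\<close> times the dimension.\<close>

lemma shear_rate_dilation:
  assumes "c \<ge> 0"
  shows "shear_rate (rate_of_strain (\<lambda>z :: real^'n. c *\<^sub>R z) x) = sqrt (2 * CARD('n)) * c"
proof -
  have "strain_invariant (rate_of_strain (\<lambda>z :: real^'n. c *\<^sub>R z) x) = 2 * (2 * CARD('n) * c\<^sup>2)"
    unfolding strain_invariant_eq_double_contraction[OF transpose_rate_of_strain]
    by (simp add: double_contraction_def rate_of_strain_dilation mat_def if_distrib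
        if_distribR power2_eq_square cong: if_cong)
  then show ?thesis
    using assms by (simp add: shear_rate_def real_sqrt_mult)
qed

lemma ex_flow_with_shear_rate:
  assumes "g \<ge> 0"
  obtains v :: "real^'n \<Rightarrow> real^'n" where "v differentiable (at 0)"
    and "shear_rate (rate_of_strain v 0) = g"
proof
  \<comment> \<open>Inverts the factor in \<open>shear_rate_dilation\<close>; the dimension is
    positive since index types are nonempty.\<close>
  let ?c = "g / sqrt (2 * CARD('n))"
  show "(\<lambda>z :: real^'n. ?c *\<^sub>R z) differentiable (at 0)"
    by simp
  show "shear_rate (rate_of_strain (\<lambda>z :: real^'n. ?c *\<^sub>R z) 0) = g"
    using assms by (simp add: shear_rate_dilation)
qed

theorem mainTheorem3:
  fixes \<mu> :: "real \<Rightarrow> real"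
  assumes smooth: "smooth_within {0..} \<mu>"
    and nonneg: "\<And>I. I \<ge> 0 \<Longrightarrow> \<mu> I \<ge> 0"
  shows "((\<forall>I\<ge>0. \<mu> I + 2 * min (deriv_nonneg \<mu> I) 0 * I \<ge> 0) \<longleftrightarrow>
          (\<forall>\<gamma>\<ge>0. deriv_nonneg (\<lambda>g. g * shear_viscosity \<mu> g) \<gamma> \<ge> 0))
    \<and> (\<forall>(v :: real^'n \<Rightarrow> real^'n) x. v differentiable (at x) \<longrightarrow>
          stress_magnitude \<mu> (rate_of_strain v x) =
            sqrt 2 * shear_rate (rate_of_strain v x)
              * shear_viscosity \<mu> (shear_rate (rate_of_strain v x)))
    \<and> ((\<forall>\<gamma>\<ge>0. deriv_nonneg (\<lambda>g. g * shear_viscosity \<mu> g) \<gamma> \<ge> 0) \<longleftrightarrow>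
          mono_on {0..} (\<lambda>g. sqrt 2 * g * shear_viscosity \<mu> g))
    \<and> ((\<forall>\<gamma>\<ge>0. deriv_nonneg (\<lambda>g. g * shear_viscosity \<mu> g) \<gamma> \<ge> 0) \<longleftrightarrow>
          (\<forall>(v :: real^'n \<Rightarrow> real^'n) x (w :: real^'n \<Rightarrow> real^'n) y.
             v differentiable (at x) \<longrightarrow> w differentiable (at y) \<longrightarrow>
             shear_rate (rate_of_strain v x) \<le> shear_rate (rate_of_strain w y) \<longrightarrow>
             stress_magnitude \<mu> (rate_of_strain v x) \<le> stress_magnitude \<mu> (rate_of_strain w y)))"
proof (intro conjI)
  let ?d = "\<lambda>\<gamma>. \<mu> (2 * \<gamma>\<^sup>2) + 2 * deriv_nonneg \<mu> (2 * \<gamma>\<^sup>2) * (2 * \<gamma>\<^sup>2)"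
  have deriv: "((\<lambda>g. g * shear_viscosity \<mu> g) has_real_derivative ?d \<gamma>) (at \<gamma> within {0..})" for \<gamma>
    by (intro has_real_derivative_shear_stress smooth_within_atLeast_has_deriv_nonneg smooth) simp
  then have deriv_eq: "deriv_nonneg (\<lambda>g. g * shear_viscosity \<mu> g) \<gamma> = ?d \<gamma>" if "\<gamma> \<ge> 0" for \<gamma>
    using deriv_nonneg_eqI that by blast
  \<comment> \<open>If the derivative is nonnegative, both sides hold; otherwise the minimum is the
    derivative itself.\<close>
  have "(\<mu> I + 2 * min (deriv_nonneg \<mu> I) 0 * I \<ge> 0) \<longleftrightarrow> (\<mu> I + 2 * deriv_nonneg \<mu> I * I \<ge> 0)"
    if "I \<ge> 0" for I
    using nonneg[OF that] that by (cases "deriv_nonneg \<mu> I \<ge> 0") simp_all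
  then show "(\<forall>I\<ge>0. \<mu> I + 2 * min (deriv_nonneg \<mu> I) 0 * I \<ge> 0) \<longleftrightarrow>
      (\<forall>\<gamma>\<ge>0. deriv_nonneg (\<lambda>g. g * shear_viscosity \<mu> g) \<gamma> \<ge> 0)"
    using all_nonneg_iff_all_double_square[of "\<lambda>I. \<mu> I + 2 * deriv_nonneg \<mu> I * I \<ge> 0"]
    by (simp add: deriv_eq)
  have magnitude: "stress_magnitude \<mu> (rate_of_strain v x) =
      sqrt 2 * shear_rate (rate_of_strain v x) * shear_viscosity \<mu> (shear_rate (rate_of_strain v x))"
    for v :: "real^'n \<Rightarrow> real^'n" and x
    using stress_magnitude_eq[OF transpose_rate_of_strain] nonneg by blast
  then show "\<forall>(v :: real^'n \<Rightarrow> real^'n) x. v differentiable (at x) \<longrightarrow>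
      stress_magnitude \<mu> (rate_of_strain v x) =
      sqrt 2 * shear_rate (rate_of_strain v x)
        * shear_viscosity \<mu> (shear_rate (rate_of_strain v x))"
    by blast
  have "(\<forall>\<gamma>\<ge>0. ?d \<gamma> \<ge> 0) \<longleftrightarrow> mono_on {0..} (\<lambda>g. g * shear_viscosity \<mu> g)"
    using mono_on_atLeast_iff_deriv_nonneg[OF deriv] by blast
  also have "\<dots> \<longleftrightarrow> mono_on {0..} (\<lambda>g. sqrt 2 * g * shear_viscosity \<mu> g)"
    by (simp add: mono_on_def mult.assoc)
  finally show mono: "(\<forall>\<gamma>\<ge>0. deriv_nonneg (\<lambda>g. g * shear_viscosity \<mu> g) \<gamma> \<ge> 0) \<longleftrightarrow>
      mono_on {0..} (\<lambda>g. sqrt 2 * g * shear_viscosity \<mu> g)"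
    by (simp add: deriv_eq)
  have "mono_on {0..} (\<lambda>g. sqrt 2 * g * shear_viscosity \<mu> g) \<longleftrightarrow>
      (\<forall>(v :: real^'n \<Rightarrow> real^'n) x (w :: real^'n \<Rightarrow> real^'n) y.
        v differentiable (at x) \<longrightarrow> w differentiable (at y) \<longrightarrow>
        shear_rate (rate_of_strain v x) \<le> shear_rate (rate_of_strain w y) \<longrightarrow>
        stress_magnitude \<mu> (rate_of_strain v x) \<le> stress_magnitude \<mu> (rate_of_strain w y))"
    (is "?mono \<longleftrightarrow> ?flows")
  proof
    assume ?mono
    \<comment> \<open>Shear rates lie in \<open>{0..}\<close> by symmetry of the rate of strain, so
      monotonicity there applies to them.\<close>
    then show ?flows
      by (simp add: magnitude mono_on_def shear_rate_nonneg[OF transpose_rate_of_strain])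
  next
    assume flows: ?flows
    show ?mono
    proof (rule mono_onI)
      fix r s :: real assume rs: "r \<in> {0..}" "s \<in> {0..}" "r \<le> s"
      \<comment> \<open>Realizing both \<open>r\<close> and \<open>s\<close> as shear rates of flows
        turns the comparison of flows into one of numbers.\<close>
      obtain v :: "real^'n \<Rightarrow> real^'n" where v: "v differentiable (at 0)"
        "shear_rate (rate_of_strain v 0) = r"
        using rs ex_flow_with_shear_rate by (metis atLeast_iff)
      obtain w :: "real^'n \<Rightarrow> real^'n" where w: "w differentiable (at 0)"
        "shear_rate (rate_of_strain w 0) = s"
        using rs ex_flow_with_shear_rate by (metis atLeast_iff)
      show "sqrt 2 * r * shear_viscosity \<mu> r \<le> sqrt 2 * s * shear_viscosity \<mu> s"
        using flows v w \<open>r \<le> s\<close> magnitude by metis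
    qed
  qed
  with mono show "(\<forall>\<gamma>\<ge>0. deriv_nonneg (\<lambda>g. g * shear_viscosity \<mu> g) \<gamma> \<ge> 0) \<longleftrightarrow>
      (\<forall>(v :: real^'n \<Rightarrow> real^'n) x (w :: real^'n \<Rightarrow> real^'n) y.
        v differentiable (at x) \<longrightarrow> w differentiable (at y) \<longrightarrow>
        shear_rate (rate_of_strain v x) \<le> shear_rate (rate_of_strain w y) \<longrightarrow>
        stress_magnitude \<mu> (rate_of_strain v x) \<le> stress_magnitude \<mu> (rate_of_strain w y))"
    by simp
qed

end
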